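(* Let $a_1,\ldots,a_n$ be nonnegative integers and let $r$ and $s$ be distinct integers with $1\leq r,s\leq n$. Then $$\mathrm{CT}_{\mathbf{x}}\ \frac{x_s^2}{x_r^2}D_n(\mathbf{x},\mathbf{a})=\frac{a_r}{(1+a^{(r)})(2+a^{(r)})}\bigg[(a_r-1)-\sum_{\substack{1\le i\le n\\ i\neq r,s}}\frac{a_i(1+a)}{1+a^{(r)}-a_i}\bigg]C_n(\mathbf{a}).$$
   Context: For nonnegative integers $a_1,\ldots,a_n$, write $\mathbf{a}=(a_1,\ldots,a_n)$ and $\mathbf{x}=(x_1,\ldots,x_n)$ (indeterminates). The Dyson product is the Laurent polynomial $D_n(\mathbf{x},\mathbf{a}):=\prod_{1\le i\ne j\le n}\left(1-\frac{x_i}{x_j}\right)^{a_i}$ (product over all ordered pairs $(i,j)$ with $i\neq j$). $\mathrm{CT}_{\mathbf{x}}f(\mathbf{x})$ denotes the constant term of the Laurent polynomial $f$ in the variables $x_1,\ldots,x_n$, i.e. the coefficient of $x_1^0\cdots x_n^0$. Set $a:=a_1+a_2+\cdots+a_n$, $a^{(j)}:=a-a_j$, and $C_n(\mathbf{a}):=\frac{(a_1+a_2+\cdots+a_n)!}{a_1!\,a_2!\cdots a_n!}$. *)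

theory Defs
  imports Complex_Main "HOL-Library.Poly_Mapping"
begin

text \<open>
  Laurent polynomials in indeterminates \<open>x\<^sub>0, x\<^sub>1, x\<^sub>2, \<dots>\<close> over \<open>'a\<close>, as the group algebra of the
  finitely supported integer exponent vectors: finitely supported functions from exponent vectors
  to coefficients, multiplied by convolution.  A Laurent polynomial in \<open>x\<^sub>1, \<dots>, x\<^sub>n\<close> is one that
  involves no other indeterminate.
\<close>

type_synonym 'a laurent = "(nat \<Rightarrow>\<^sub>0 int) \<Rightarrow>\<^sub>0 'a"

definition xpow :: "nat \<Rightarrow> int \<Rightarrow> 'a::comm_ring_1 laurent" where
  "xpow i k = Poly_Mapping.single (Poly_Mapping.single i k) 1"

text \<open>\<open>xpow i k\<close> is the unit \<open>x\<^sub>i\<^sup>k\<close>; the lemmas justify writing \<open>x\<^sub>i / x\<^sub>j\<close> as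
  \<open>xpow i 1 * xpow j (- 1)\<close>.\<close>

lemma xpow_0: "xpow i 0 = 1"
  by (simp add: xpow_def)

lemma xpow_add: "xpow i (k + l) = xpow i k * xpow i l"
  by (simp add: xpow_def mult_single single_add)

definition constant_term :: "'a::zero laurent \<Rightarrow> 'a" where
  "constant_term f = Poly_Mapping.lookup f 0"

definition dyson_product :: "nat \<Rightarrow> (nat \<Rightarrow> nat) \<Rightarrow> 'a::comm_ring_1 laurent" where
  "dyson_product n a =
     (\<Prod>(i, j) \<in> {(i, j). i \<in> {1..n} \<and> j \<in> {1..n} \<and> i \<noteq> j}. (1 - xpow i 1 * xpow j (- 1)) ^ a i)"

definition dyson_sum :: "nat \<Rightarrow> (nat \<Rightarrow> nat) \<Rightarrow> nat" where
  "dyson_sum n a = (\<Sum>i = 1..n. a i)"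

text \<open>The subtraction on \<open>nat\<close> is exact for \<open>j \<in> {1..n}\<close>.\<close>

definition dyson_sum_except :: "nat \<Rightarrow> (nat \<Rightarrow> nat) \<Rightarrow> nat \<Rightarrow> nat" where
  "dyson_sum_except n a j = dyson_sum n a - a j"

definition dyson_coeff :: "nat \<Rightarrow> (nat \<Rightarrow> nat) \<Rightarrow> rat" where
  "dyson_coeff n a = fact (dyson_sum n a) / (\<Prod>i = 1..n. fact (a i))"

end

theory Submission
  imports Defs "HOL-Computational_Algebra.Polynomial_Factorial"
begin

text \<open>
  The proof is the one that Good gave for Dyson's conjecture, applied to the coefficients of all
  monomials of the shape \<open>x\<^sub>s x\<^sub>t / x\<^sub>r\<^sup>2\<close> at once.  Good's observation is that Lagrange interpolation
  of the constant \<open>1\<close> at the points \<open>x\<^sub>i\<close> gives, when all exponents \<open>a\<^sub>k\<close> are positive, the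
  recurrence \<open>D(a) = (\<Sum>k. D(a - e\<^sub>k))\<close> (\<open>dyson_good_recurrence\<close>).  Hence every
  fixed coefficient of \<open>D\<close> satisfies the recurrence of the multinomial coefficient, and a formula for
  it follows by induction (\<open>good_induct\<close>) once it is known to obey the same recurrence and the right
  boundary conditions at \<open>a\<^sub>k = 0\<close>.

  If \<open>a\<^sub>k = 0\<close>, then \<open>D\<close> is the Dyson product in the other variables times
  \<open>(\<Prod>i. (1 - x\<^sub>i / x\<^sub>k) ^ a\<^sub>i)\<close>, which has no positive powers of \<open>x\<^sub>k\<close>; so \<open>x\<^sub>k\<close> is eliminated
  by reading off the coefficient of \<open>x\<^sub>k ^ (- d)\<close> in that product, where \<open>d\<close> is the exponent of \<open>x\<^sub>k\<close>
  in the monomial in front (\<open>dyson_ct_zero_exponent\<close>).  For \<open>d = 2\<close> that coefficient is a quadratic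
  form in the remaining variables.  So the boundary value of the coefficient belonging to
  \<open>x\<^sub>s\<^sup>2 / x\<^sub>r\<^sup>2\<close> involves \<open>x\<^sub>i x\<^sub>j / x\<^sub>r\<^sup>2\<close> for all pairs \<open>i\<close>, \<open>j\<close>, including \<open>x\<^sub>j / x\<^sub>r\<close> (one of them
  is \<open>r\<close>) and \<open>1\<close> (both are).  This family is closed under the elimination, and this is why the
  theorem is proved together with the formulas for \<open>1\<close> (\<open>dyson_constant_term\<close>, Dyson's conjecture),
  \<open>x\<^sub>s / x\<^sub>r\<close> (\<open>dyson_ct_first_order\<close>) and \<open>x\<^sub>s x\<^sub>t / x\<^sub>r\<^sup>2\<close> with \<open>s\<close>, \<open>t\<close> different from \<open>r\<close>
  (\<open>dyson_ct_second_order\<close>).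

  With \<open>p = a\<^sub>r\<close>, \<open>A\<close> the sum of the other exponents and \<open>C\<close> the multinomial coefficient, the last
  formula is
  \<open>p / ((1 + A) (2 + A)) * (2 p + A - (1 + p + A) ([s = t] + (\<Sum>j \<notin> {r, s, t}. a\<^sub>j / (1 + A - a\<^sub>j)))) C\<close>;
  for \<open>s = t\<close> it is the theorem.  Each of its summands obeys the recurrence separately
  (\<open>second_order_factor_recurrence\<close>).  The boundary conditions reduce to three weighted sums of
  the inner bracket (\<open>weighted_correction_left\<close>, \<open>weighted_correction_both\<close>,
  \<open>weighted_correction_diag\<close>).
\<close>

section \<open>The Dyson product over a finite index set and Good's recurrence\<close>

text \<open>
  The summands are the values at \<open>0\<close> of the Lagrange basis polynomials for the nodes \<open>x\<^sub>k\<close>, and the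
  basis polynomials add up to the polynomial \<open>1\<close>, which they interpolate.
\<close>

lemma lagrange_basis_sum_at_zero:
  fixes x :: "'b \<Rightarrow> 'f::field"
  assumes "finite I" "I \<noteq> {}" "inj_on x I"
  shows "(\<Sum>k\<in>I. \<Prod>j\<in>I - {k}. x j / (x j - x k)) = 1"
proof -
  define L where "L k = (\<Prod>j\<in>I - {k}. [:x j / (x j - x k), - 1 / (x j - x k):])" for k
  have poly_L: "poly (L k) z = (\<Prod>j\<in>I - {k}. (x j - z) / (x j - x k))" for k z
    by (simp add: L_def poly_prod diff_divide_distrib mult.commute)
  \<comment> \<open>\<open>L k\<close> is the Lagrange basis polynomial of the node \<open>x k\<close>.\<close>
  have eval: "poly (L k) (x i) = (if k = i then 1 else 0)" if "k \<in> I" "i \<in> I" for k i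
  proof (cases "k = i")
    case True
    have "x j - x i \<noteq> 0" if "j \<in> I - {i}" for j
      using assms(3) \<open>i \<in> I\<close> that by (auto simp: inj_on_def)
    then show ?thesis using True by (simp add: poly_L)
  next
    case False
    then show ?thesis using that assms(1) by (auto simp: poly_L intro!: prod_zero)
  qed
  have deg: "degree (L k) \<le> card I - 1" if "k \<in> I" for k
  proof -
    have "degree (L k) \<le> (\<Sum>j\<in>I - {k}. degree [:x j / (x j - x k), - 1 / (x j - x k):])"
      unfolding L_def using assms(1) by (intro order_trans[OF degree_prod_sum_le]) (simp_all add: o_def)
    also have "\<dots> \<le> (\<Sum>j\<in>I - {k}. 1)"
      by (intro sum_mono) simp
    finally show ?thesis using that by simp
  qed
  have "(\<Sum>k\<in>I. L k) = 1"
  proof (rule poly_eqI_degree)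
    show "poly (\<Sum>k\<in>I. L k) z = poly 1 z" if "z \<in> x ` I" for z
      using that assms(1) by (auto simp: poly_sum eval)
    have "degree (\<Sum>k\<in>I. L k) \<le> card I - 1"
      using deg assms(1) by (intro degree_sum_le) auto
    moreover have "card (x ` I) = card I" "card I > 0"
      using assms by (auto simp: card_image card_gt_0_iff)
    ultimately show "degree (\<Sum>k\<in>I. L k) < card (x ` I)" "degree (1 :: 'f poly) < card (x ` I)"
      by auto
  qed
  then have "poly (\<Sum>k\<in>I. L k) 0 = 1" by simp
  then show ?thesis by (simp add: poly_sum poly_L)
qed

abbreviation unit_exp :: "nat \<Rightarrow> (nat \<Rightarrow>\<^sub>0 int)" where
  "unit_exp i \<equiv> Poly_Mapping.single i 1"

abbreviation monomial :: "(nat \<Rightarrow>\<^sub>0 int) \<Rightarrow> 'a::comm_ring_1 laurent" where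
  "monomial \<alpha> \<equiv> Poly_Mapping.single \<alpha> 1"

text \<open>
  Good's identity is a relation between these products; in the Dyson product all factors of one of
  them carry the same exponent.
\<close>

definition star :: "nat set \<Rightarrow> nat \<Rightarrow> 'a::comm_ring_1 laurent" where
  "star I i = (\<Prod>j\<in>I - {i}. 1 - xpow i 1 * xpow j (- 1))"

text \<open>
  The induction removes indices from the middle of \<open>{1..n}\<close>, so the index set is arbitrary.
\<close>

definition dyson :: "nat set \<Rightarrow> (nat \<Rightarrow> nat) \<Rightarrow> 'a::comm_ring_1 laurent" where
  "dyson I a = (\<Prod>i\<in>I. star I i ^ a i)"

lemma dyson_product_eq: "dyson_product n a = dyson {1..n} a"
proof -
  have "dyson {1..n} a
      = (\<Prod>i\<in>{1..n}. \<Prod>j\<in>{1..n} - {i}. (1 - xpow i 1 * xpow j (- 1)) ^ a i :: 'a laurent)"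
    by (simp add: dyson_def star_def prod_power_distrib)
  also have "\<dots> = (\<Prod>(i, j)\<in>(SIGMA i:{1..n}. {1..n} - {i}).
      (1 - xpow i 1 * xpow j (- 1)) ^ a i)"
    by (rule prod.Sigma) auto
  also have "(SIGMA i:{1..n}. {1..n} - {i}) = {(i, j). i \<in> {1..n} \<and> j \<in> {1..n} \<and> i \<noteq> j}"
    by auto
  finally show ?thesis by (simp add: dyson_product_def)
qed

text \<open>
  After division by the left-hand side this says that the reciprocals of the \<open>star I k\<close> add up
  to \<open>1\<close>, which is the Lagrange identity because
  \<open>1 / (1 - x\<^sub>k / x\<^sub>j) = x\<^sub>j / (x\<^sub>j - x\<^sub>k)\<close>.  The division takes place in the field of fractions
  of the ring of Laurent polynomials.
\<close>

lemma prod_star_eq_sum: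
  assumes "finite I" "I \<noteq> {}"
  shows "(\<Prod>i\<in>I. star I i :: 'a::idom laurent) = (\<Sum>k\<in>I. \<Prod>i\<in>I - {k}. star I i)"
proof -
  define x where "x i = to_fract (xpow i 1 :: 'a laurent)" for i
  have hom_prod: "to_fract (\<Prod>i\<in>J. f i) = (\<Prod>i\<in>J. to_fract (f i))"
    for J :: "nat set" and f :: "nat \<Rightarrow> 'a laurent"
    by (induction J rule: infinite_finite_induct) simp_all
  have hom_sum: "to_fract (\<Sum>i\<in>J. f i) = (\<Sum>i\<in>J. to_fract (f i))"
    for J :: "nat set" and f :: "nat \<Rightarrow> 'a laurent"
    by (induction J rule: infinite_finite_induct) simp_all
  have inj: "inj x"
  proof (rule injI)
    fix i j assume "x i = x j"
    then have "Poly_Mapping.keys (xpow i 1 :: 'a laurent) = Poly_Mapping.keys (xpow j 1 :: 'a laurent)"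
      by (simp add: x_def)
    then have "Poly_Mapping.keys (unit_exp i) = Poly_Mapping.keys (unit_exp j)"
      by (simp add: xpow_def)
    then show "i = j" by simp
  qed
  have x_inverse: "x i * to_fract (xpow i (- 1)) = 1" for i
    using xpow_add[of i 1 "- 1", where 'a = 'a]
    by (simp add: x_def xpow_0 flip: to_fract_mult)
  have x_nonzero: "x i \<noteq> 0" for i
    using x_inverse[of i] by auto
  have factor: "to_fract (1 - xpow i 1 * xpow j (- 1)) = (x j - x i) / x j" for i j
  proof -
    have "to_fract (xpow j (- 1)) = 1 / x j"
      using x_inverse[of j] x_nonzero[of j] by (simp add: field_simps)
    then show ?thesis
      using x_nonzero[of j] by (simp add: x_def[symmetric] diff_divide_distrib)
  qed
  have star: "to_fract (star I k) = (\<Prod>j\<in>I - {k}. (x j - x k) / x j)" for k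
    by (simp only: star_def hom_prod factor)
  have star_nonzero: "to_fract (star I k :: 'a laurent) \<noteq> 0" for k
    unfolding star using inj x_nonzero assms(1) by (auto simp: inj_def)
  have "to_fract (\<Sum>k\<in>I. \<Prod>i\<in>I - {k}. star I i :: 'a laurent)
      = (\<Sum>k\<in>I. to_fract (\<Prod>i\<in>I. star I i) * (1 / to_fract (star I k)))"
    unfolding hom_sum
  proof (rule sum.cong)
    fix k assume "k \<in> I"
    then have "(\<Prod>i\<in>I. star I i :: 'a laurent) = star I k * (\<Prod>i\<in>I - {k}. star I i)"
      using assms(1) by (simp add: prod.remove)
    then show "to_fract (\<Prod>i\<in>I - {k}. star I i :: 'a laurent)
        = to_fract (\<Prod>i\<in>I. star I i) * (1 / to_fract (star I k))"
      using star_nonzero[of k] by simp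
  qed simp
  also have "\<dots> = to_fract (\<Prod>i\<in>I. star I i)
      * (\<Sum>k\<in>I. \<Prod>j\<in>I - {k}. x j / (x j - x k))"
    unfolding sum_distrib_left[symmetric] star by (simp add: prod_dividef)
  also have "\<dots> = to_fract (\<Prod>i\<in>I. star I i)"
    using lagrange_basis_sum_at_zero[OF assms inj_on_subset[OF inj]] by simp
  finally show ?thesis
    by (simp only: to_fract_eq_iff)
qed

text \<open>
  The identity \<open>prod_star_eq_sum\<close> multiplied by \<open>(\<Prod>i\<in>I. star I i ^ (a i - 1))\<close>.
\<close>

lemma dyson_good_recurrence:
  assumes "finite I" "I \<noteq> {}" and pos: "\<And>i. i \<in> I \<Longrightarrow> a i > 0"
  shows "(dyson I a :: 'a::idom laurent) = (\<Sum>k\<in>I. dyson I (a(k := a k - 1)))"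
proof -
  let ?R = "\<Prod>i\<in>I. star I i ^ (a i - 1) :: 'a laurent"
  have "dyson I a = (\<Prod>i\<in>I. star I i :: 'a laurent) * ?R"
    unfolding dyson_def prod.distrib[symmetric]
    using pos by (intro prod.cong) (auto simp flip: power_Suc)
  also have "\<dots> = (\<Sum>k\<in>I. (\<Prod>i\<in>I - {k}. star I i) * ?R)"
    by (simp add: prod_star_eq_sum[OF assms(1,2)] sum_distrib_right)
  also have "\<dots> = (\<Sum>k\<in>I. dyson I (a(k := a k - 1)))"
  proof (rule sum.cong)
    fix k assume k: "k \<in> I"
    have "dyson I (a(k := a k - 1))
        = star I k ^ (a k - 1) * (\<Prod>i\<in>I - {k}. star I i ^ a i :: 'a laurent)"
      using assms(1) k unfolding dyson_def by (simp add: prod.remove)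
    also have "(\<Prod>i\<in>I - {k}. star I i ^ a i)
        = (\<Prod>i\<in>I - {k}. star I i) * (\<Prod>i\<in>I - {k}. star I i ^ (a i - 1) :: 'a laurent)"
      unfolding prod.distrib[symmetric]
      using pos by (intro prod.cong) (auto simp flip: power_Suc)
    finally have eq: "dyson I (a(k := a k - 1)) = star I k ^ (a k - 1) *
        ((\<Prod>i\<in>I - {k}. star I i) * (\<Prod>i\<in>I - {k}. star I i ^ (a i - 1) :: 'a laurent))" .
    show "(\<Prod>i\<in>I - {k}. star I i) * ?R = dyson I (a(k := a k - 1))"
      by (simp only: eq prod.remove[OF assms(1) k] mult_ac)
  qed simp
  finally show ?thesis .
qed

text \<open>
  The factors \<open>1 - x\<^sub>k / x\<^sub>i\<close> have exponent \<open>a k = 0\<close>, so \<open>x\<^sub>k\<close> remains only in the factors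
  \<open>1 - x\<^sub>i / x\<^sub>k\<close>.
\<close>

lemma dyson_zero_exponent:
  assumes "finite I" "k \<in> I" "a k = 0"
  shows "dyson I a = dyson (I - {k}) a *
    (\<Prod>i\<in>I - {k}. (1 - monomial (unit_exp i - unit_exp k)) ^ a i :: 'a::comm_ring_1 laurent)"
proof -
  have "star I i = star (I - {k}) i * (1 - monomial (unit_exp i - unit_exp k) :: 'a laurent)"
    if "i \<in> I - {k}" for i
  proof -
    have "I - {i} = insert k (I - {k} - {i})"
      using that assms(2) by auto
    moreover have "xpow i 1 * xpow k (- 1) = (monomial (unit_exp i - unit_exp k) :: 'a laurent)"
      by (simp add: xpow_def mult_single single_uminus)
    ultimately show ?thesis
      using assms(1) by (simp add: star_def mult.commute)
  qed
  then show ?thesis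
    using assms by (simp add: dyson_def prod.remove[of I k] power_mult_distrib prod.distrib)
qed

section \<open>Elimination of a variable with exponent zero\<close>

text \<open>
  The set of exponents with which \<open>x\<^sub>k\<close> occurs in \<open>f\<close>.  An inclusion
  \<open>xdegs k f \<subseteq> {..d}\<close> plays the part of an error term \<open>O(x\<^sub>k ^ d)\<close> in expansions in powers of
  \<open>1 / x\<^sub>k\<close>.
\<close>

definition xdegs :: "nat \<Rightarrow> 'a::zero laurent \<Rightarrow> int set" where
  "xdegs k f = (\<lambda>m. Poly_Mapping.lookup m k) ` Poly_Mapping.keys f"

lemma xdegs_mult: "xdegs k (f * g) \<subseteq> {u + v | u v. u \<in> xdegs k f \<and> v \<in> xdegs k g}"
  for f g :: "'a::comm_ring_1 laurent"
  using keys_mult[of f g] by (fastforce simp: xdegs_def lookup_add)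

lemma xdegs_mult_le:
  fixes f g :: "'a::comm_ring_1 laurent"
  assumes "xdegs k f \<subseteq> {..b}" "xdegs k g \<subseteq> {..c}" "b + c \<le> d"
  shows "xdegs k (f * g) \<subseteq> {..d}"
  using xdegs_mult[of k f g] assms by fastforce

lemma xdegs_add_le:
  fixes f g :: "'a::comm_ring_1 laurent"
  assumes "xdegs k f \<subseteq> {..d}" "xdegs k g \<subseteq> {..d}"
  shows "xdegs k (f + g) \<subseteq> {..d}"
  using keys_add[of f g] assms by (fastforce simp: xdegs_def)

lemma xdegs_diff: "xdegs k (f - g) \<subseteq> xdegs k f \<union> xdegs k g"
  for f g :: "'a::comm_ring_1 laurent"
  using keys_diff[of f g] by (fastforce simp: xdegs_def)

lemma xdegs_diff_le:
  fixes f g :: "'a::comm_ring_1 laurent"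
  assumes "xdegs k f \<subseteq> {..d}" "xdegs k g \<subseteq> {..d}"
  shows "xdegs k (f - g) \<subseteq> {..d}"
  using xdegs_diff[of k f g] assms by blast

lemma xdegs_zero [simp]: "xdegs k 0 = {}"
  by (simp add: xdegs_def)

lemma xdegs_one [simp]: "xdegs k (1 :: 'a::comm_ring_1 laurent) = {0}"
  by (simp add: xdegs_def)

lemma xdegs_monomial [simp]:
  "xdegs k (monomial \<alpha> :: 'a::comm_ring_1 laurent) = {Poly_Mapping.lookup \<alpha> k}"
  by (simp add: xdegs_def)

lemma constant_term_eq_0: "0 \<notin> xdegs k f \<Longrightarrow> constant_term f = 0"
  by (force simp: xdegs_def constant_term_def in_keys_iff)

lemma xdegs_dyson:
  assumes "k \<notin> I"
  shows "xdegs k (dyson I a :: 'a::comm_ring_1 laurent) \<subseteq> {0}"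
proof -
  have mult: "xdegs k (f * g) \<subseteq> {0}" if "xdegs k f \<subseteq> {0}" "xdegs k g \<subseteq> {0}"
    for f g :: "'a laurent"
    using xdegs_mult[of k f g] that by fastforce
  have prod: "xdegs k (\<Prod>i\<in>J. f i) \<subseteq> {0}" if "\<And>i. i \<in> J \<Longrightarrow> xdegs k (f i) \<subseteq> {0}"
    for J :: "nat set" and f :: "nat \<Rightarrow> 'a laurent"
    using that by (induction J rule: infinite_finite_induct) (simp_all add: mult)
  have power: "xdegs k (f ^ m) \<subseteq> {0}" if "xdegs k f \<subseteq> {0}" for m and f :: "'a laurent"
    using that by (induction m) (simp_all add: mult)
  have "xdegs k (1 - xpow i 1 * xpow j (- 1) :: 'a laurent) \<subseteq> {0}" if "i \<in> I" "j \<in> I" for i j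
  proof -
    have "xpow i 1 * xpow j (- 1)
        = (monomial (unit_exp i + Poly_Mapping.single j (- 1)) :: 'a laurent)"
      by (simp add: xpow_def mult_single)
    moreover have "Poly_Mapping.lookup (unit_exp i + Poly_Mapping.single j (- 1)) k = 0"
      using that assms by (auto simp: lookup_add lookup_single when_def)
    ultimately show ?thesis
      using xdegs_diff[of k 1 "xpow i 1 * xpow j (- 1) :: 'a laurent"] by simp
  qed
  then show ?thesis
    unfolding dyson_def star_def by (intro prod power) auto
qed

text \<open>
  \<open>Q = 1 - e + (e\<^sup>2 - p) / 2 + \<dots>\<close> in powers of \<open>1 / x\<^sub>k\<close>, doubled to avoid the division.  For a
  product of factors \<open>1 - u\<close>, \<open>e\<close> and \<open>p\<close> are the first two power sums of the \<open>u\<close>, and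
  \<open>(e\<^sup>2 - p) / 2\<close> is their second elementary symmetric polynomial.
\<close>

definition second_order_expansion :: "nat \<Rightarrow> 'a::comm_ring_1 laurent \<Rightarrow> 'a laurent \<Rightarrow> 'a laurent \<Rightarrow> bool" where
  "second_order_expansion k Q e p \<longleftrightarrow> xdegs k e \<subseteq> {..-1} \<and> xdegs k p \<subseteq> {..-2} \<and>
     xdegs k (2 * Q - (2 - 2 * e + e * e - p)) \<subseteq> {..-3}"

lemma second_order_expansion_mult:
  assumes "second_order_expansion k Q e p" "xdegs k u \<subseteq> {..-1}"
  shows "second_order_expansion k (Q * (1 - u)) (e + u) (p + u * u)"
proof -
  let ?h = "2 * Q - (2 - 2 * e + e * e - p)"
  have e: "xdegs k e \<subseteq> {..-1}" and p: "xdegs k p \<subseteq> {..-2}" and h: "xdegs k ?h \<subseteq> {..-3}"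
    using assms(1) by (simp_all add: second_order_expansion_def)
  have u: "xdegs k u \<subseteq> {..0}" using assms(2) by fastforce
  have uu: "xdegs k (u * u) \<subseteq> {..-2}" and ee: "xdegs k (e * e) \<subseteq> {..-2}"
    using xdegs_mult_le[OF assms(2) assms(2)] xdegs_mult_le[OF e e] by simp_all
  \<comment> \<open>The new error is the old one times \<open>1 - u\<close> plus the third-order term \<open>(p - e\<^sup>2) u\<close>.\<close>
  have "xdegs k (?h * (1 - u)) \<subseteq> {..-3}"
    by (rule xdegs_mult_le[OF h xdegs_diff_le[OF _ u]]) simp_all
  moreover have "xdegs k ((p - e * e) * u) \<subseteq> {..-3}"
    by (rule xdegs_mult_le[OF xdegs_diff_le[OF p ee] assms(2)]) simp
  ultimately have "xdegs k (?h * (1 - u) + (p - e * e) * u) \<subseteq> {..-3}"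
    by (rule xdegs_add_le)
  also have "?h * (1 - u) + (p - e * e) * u
      = 2 * (Q * (1 - u)) - (2 - 2 * (e + u) + (e + u) * (e + u) - (p + u * u))"
    by (simp add: algebra_simps)
  finally show ?thesis
    unfolding second_order_expansion_def using xdegs_add_le[OF e assms(2)] xdegs_add_le[OF p uu] by simp
qed

lemma second_order_expansion_prod:
  assumes "finite J" "\<And>i. i \<in> J \<Longrightarrow> xdegs k (u i) \<subseteq> {..-1}"
  shows "second_order_expansion k (\<Prod>i\<in>J. (1 - u i) ^ a i)
    (\<Sum>i\<in>J. of_nat (a i) * u i) (\<Sum>i\<in>J. of_nat (a i) * (u i * u i))"
  using assms
proof (induction J rule: finite_induct)
  case empty
  then show ?case by (simp add: second_order_expansion_def)
next
  case (insert j J)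
  let ?Q = "\<Prod>i\<in>J. (1 - u i) ^ a i"
  have "second_order_expansion k (?Q * (1 - u j) ^ m) ((\<Sum>i\<in>J. of_nat (a i) * u i) + of_nat m * u j)
      ((\<Sum>i\<in>J. of_nat (a i) * (u i * u i)) + of_nat m * (u j * u j))" for m
  proof (induction m)
    case 0
    then show ?case using insert by simp
  next
    case (Suc m)
    then show ?case
      using second_order_expansion_mult[OF Suc insert.prems[of j]] by (simp add: algebra_simps)
  qed
  from this[of "a j"] show ?case using insert.hyps by (simp add: algebra_simps)
qed

lemma constant_term_diff: "constant_term (f - g) = constant_term f - constant_term g"
  for f g :: "'a::comm_ring_1 laurent"
  by (simp add: constant_term_def lookup_minus)

lemma constant_term_add: "constant_term (f + g) = constant_term f + constant_term g"
  for f g :: "'a::comm_ring_1 laurent"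
  by (simp add: constant_term_def lookup_add)

lemma constant_term_sum: "constant_term (\<Sum>i\<in>J. f i) = (\<Sum>i\<in>J. constant_term (f i))"
  for f :: "_ \<Rightarrow> 'a::comm_ring_1 laurent"
  by (induction J rule: infinite_finite_induct)
    (simp_all add: constant_term_add, simp_all add: constant_term_def)

lemma constant_term_of_nat_mult: "constant_term (of_nat m * f) = of_nat m * constant_term f"
  for f :: "'a::comm_ring_1 laurent"
  by (induction m) (simp_all add: distrib_right constant_term_add, simp add: constant_term_def)

text \<open>
  A remainder of order \<open>-3\<close> times something of order at most \<open>2\<close> has only negative powers of \<open>x\<^sub>k\<close>, so it
  does not contribute to the constant term.
\<close>

lemma constant_term_mult_expansion:
  assumes "second_order_expansion k Q e p" "xdegs k h \<subseteq> {..2}"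
  shows "2 * constant_term (h * Q) = 2 * constant_term h - 2 * constant_term (h * e)
    + constant_term (h * (e * e)) - constant_term (h * p)"
proof -
  have two: "constant_term (2 * f) = 2 * constant_term f" for f :: "'a laurent"
    using constant_term_of_nat_mult[of 2 f] by simp
  have "xdegs k (h * (2 * Q - (2 - 2 * e + e * e - p))) \<subseteq> {..-1}"
    using assms by (intro xdegs_mult_le[of k _ 2 _ "-3"]) (auto simp: second_order_expansion_def)
  then have "constant_term (h * (2 * Q - (2 - 2 * e + e * e - p))) = 0"
    by (intro constant_term_eq_0) auto
  moreover have "h * (2 * Q - (2 - 2 * e + e * e - p))
      = 2 * (h * Q) - (2 * h - 2 * (h * e) + h * (e * e) - h * p)"
    by (simp add: algebra_simps)
  ultimately show ?thesis
    by (simp add: constant_term_diff constant_term_add two)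
qed

definition dyson_ct :: "nat set \<Rightarrow> (nat \<Rightarrow>\<^sub>0 int) \<Rightarrow> (nat \<Rightarrow> nat) \<Rightarrow> 'a::comm_ring_1" where
  "dyson_ct I \<alpha> a = constant_term (monomial \<alpha> * dyson I a)"

lemma dyson_ct_good_recurrence:
  assumes "finite I" "I \<noteq> {}" "\<And>i. i \<in> I \<Longrightarrow> a i > 0"
  shows "(dyson_ct I \<alpha> a :: 'a::idom) = (\<Sum>k\<in>I. dyson_ct I \<alpha> (a(k := a k - 1)))"
  by (simp add: dyson_ct_def dyson_good_recurrence[OF assms] sum_distrib_left constant_term_sum)

lemma dyson_ct_eq_0:
  assumes "k \<notin> I" "Poly_Mapping.lookup \<alpha> k \<noteq> 0"
  shows "dyson_ct I \<alpha> a = 0"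
  unfolding dyson_ct_def
proof (rule constant_term_eq_0)
  show "0 \<notin> xdegs k (monomial \<alpha> * dyson I a :: 'a laurent)"
    using xdegs_mult[of k "monomial \<alpha>" "dyson I a :: 'a laurent"] xdegs_dyson[OF assms(1), of a, where 'a='a] assms(2)
    by fastforce
qed

text \<open>
  The expansion up to second order suffices for all exponents of \<open>x\<^sub>k\<close> in the monomial that are at
  most \<open>2\<close>.  The four specialisations below keep the terms in which the powers of \<open>x\<^sub>k\<close> cancel.
\<close>

lemma dyson_ct_zero_exponent:
  assumes "finite I" "k \<in> I" "a k = 0" "Poly_Mapping.lookup \<alpha> k \<le> 2"
  defines "J \<equiv> I - {k}"
  shows "2 * dyson_ct I \<alpha> a = (2 * dyson_ct J \<alpha> a
    - 2 * (\<Sum>i\<in>J. of_nat (a i) * dyson_ct J (\<alpha> + unit_exp i - unit_exp k) a)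
    + (\<Sum>i\<in>J. \<Sum>j\<in>J. of_nat (a i) * of_nat (a j) *
         dyson_ct J (\<alpha> + unit_exp i + unit_exp j - unit_exp k - unit_exp k) a)
    - (\<Sum>i\<in>J. of_nat (a i) *
         dyson_ct J (\<alpha> + unit_exp i + unit_exp i - unit_exp k - unit_exp k) a) :: 'a::comm_ring_1)"
proof -
  define u :: "nat \<Rightarrow> 'a laurent" where "u i = monomial (unit_exp i - unit_exp k)" for i
  define h :: "'a laurent" where "h = monomial \<alpha> * dyson J a"
  define Q where "Q = (\<Prod>i\<in>J. (1 - u i) ^ a i)"
  define e where "e = (\<Sum>i\<in>J. of_nat (a i) * u i)"
  define p where "p = (\<Sum>i\<in>J. of_nat (a i) * (u i * u i))"
  have "xdegs k h \<subseteq> {..2}"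
    using xdegs_mult[of k "monomial \<alpha>" "dyson J a :: 'a laurent"] xdegs_dyson[of k J a, where 'a='a] assms(4)
    unfolding h_def J_def by fastforce
  moreover have "second_order_expansion k Q e p"
    unfolding Q_def e_def p_def using assms(1)
    by (intro second_order_expansion_prod) (auto simp: u_def J_def lookup_minus lookup_single when_def)
  moreover have "dyson_ct I \<alpha> a = constant_term (h * Q)"
    using dyson_zero_exponent[where 'a='a, of I k a] assms(1-3)
    by (simp add: dyson_ct_def h_def Q_def u_def J_def mult.assoc)
  moreover have "constant_term h = dyson_ct J \<alpha> a"
    by (simp add: h_def dyson_ct_def)
  moreover have hu: "h * u i = monomial (\<alpha> + unit_exp i - unit_exp k) * dyson J a" for i
  proof -
    have "h * u i = (monomial \<alpha> * u i) * dyson J a"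
      by (simp add: h_def mult_ac)
    also have "monomial \<alpha> * u i = monomial (\<alpha> + unit_exp i - unit_exp k)"
      by (simp add: u_def mult_single algebra_simps)
    finally show ?thesis .
  qed
  moreover have huu: "h * (u i * u j)
      = monomial (\<alpha> + unit_exp i + unit_exp j - unit_exp k - unit_exp k) * dyson J a" for i j
  proof -
    have "h * (u i * u j) = (monomial \<alpha> * (u i * u j)) * dyson J a"
      by (simp add: h_def mult_ac)
    also have "monomial \<alpha> * (u i * u j)
        = monomial (\<alpha> + unit_exp i + unit_exp j - unit_exp k - unit_exp k)"
      by (simp add: u_def mult_single algebra_simps)
    finally show ?thesis .
  qed
  moreover have "constant_term (h * e)
      = (\<Sum>i\<in>J. of_nat (a i) * dyson_ct J (\<alpha> + unit_exp i - unit_exp k) a)"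
  proof -
    have "h * e = (\<Sum>i\<in>J. of_nat (a i) * (h * u i))"
      by (simp add: e_def sum_distrib_left mult_ac)
    then show ?thesis
      by (simp only: constant_term_sum constant_term_of_nat_mult hu dyson_ct_def)
  qed
  moreover have "constant_term (h * p) = (\<Sum>i\<in>J. of_nat (a i) *
      dyson_ct J (\<alpha> + unit_exp i + unit_exp i - unit_exp k - unit_exp k) a)"
  proof -
    have "h * p = (\<Sum>i\<in>J. of_nat (a i) * (h * (u i * u i)))"
      by (simp add: p_def sum_distrib_left mult_ac)
    then show ?thesis
      by (simp only: constant_term_sum constant_term_of_nat_mult huu dyson_ct_def)
  qed
  moreover have "constant_term (h * (e * e)) = (\<Sum>i\<in>J. \<Sum>j\<in>J. of_nat (a i) * of_nat (a j) *
      dyson_ct J (\<alpha> + unit_exp i + unit_exp j - unit_exp k - unit_exp k) a)"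
  proof -
    have "h * (e * e) = (\<Sum>i\<in>J. \<Sum>j\<in>J. of_nat (a i) * (of_nat (a j) * (h * (u i * u j))))"
      by (simp add: e_def sum_product sum_distrib_left mult_ac)
    then show ?thesis
      by (simp only: constant_term_sum constant_term_of_nat_mult huu dyson_ct_def mult.assoc)
  qed
  ultimately show ?thesis
    using constant_term_mult_expansion[of k Q e p h] by (simp only:)
qed

text \<open>
  In all of these monomials \<open>x\<^sub>k\<close> has a nonzero exponent, while the Dyson product over \<open>I - {k}\<close> does not
  contain \<open>x\<^sub>k\<close>.
\<close>

lemma dyson_ct_shifted_sums_eq_0:
  fixes a :: "nat \<Rightarrow> nat"
  defines "ct \<equiv> \<lambda>I \<alpha>. dyson_ct I \<alpha> a :: 'a::comm_ring_1"
  shows "Poly_Mapping.lookup \<alpha> k \<noteq> 1 \<Longrightarrow>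
      (\<Sum>i\<in>I - {k}. of_nat (a i) * ct (I - {k}) (\<alpha> + unit_exp i - unit_exp k)) = 0"
    and "Poly_Mapping.lookup \<alpha> k \<noteq> 2 \<Longrightarrow>
      (\<Sum>i\<in>I - {k}. \<Sum>j\<in>I - {k}. of_nat (a i) * of_nat (a j) *
        ct (I - {k}) (\<alpha> + unit_exp i + unit_exp j - unit_exp k - unit_exp k)) = 0"
    and "Poly_Mapping.lookup \<alpha> k \<noteq> 2 \<Longrightarrow>
      (\<Sum>i\<in>I - {k}. of_nat (a i) *
        ct (I - {k}) (\<alpha> + unit_exp i + unit_exp i - unit_exp k - unit_exp k)) = 0"
proof -
  have *: "ct (I - {k}) \<beta> = 0" if "Poly_Mapping.lookup \<beta> k \<noteq> 0" for \<beta>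
    unfolding ct_def using that by (intro dyson_ct_eq_0[of k]) auto
  have lookup2: "Poly_Mapping.lookup (\<alpha> + unit_exp i + unit_exp j - unit_exp k - unit_exp k) k
      = Poly_Mapping.lookup \<alpha> k - 2" if "i \<in> I - {k}" "j \<in> I - {k}" for i j
    using that by (simp only: lookup_add lookup_minus lookup_single) auto
  show "Poly_Mapping.lookup \<alpha> k \<noteq> 1 \<Longrightarrow>
      (\<Sum>i\<in>I - {k}. of_nat (a i) * ct (I - {k}) (\<alpha> + unit_exp i - unit_exp k)) = 0"
    by (intro sum.neutral ballI, subst *) (auto simp: lookup_add lookup_minus lookup_single when_def)
  show "Poly_Mapping.lookup \<alpha> k \<noteq> 2 \<Longrightarrow>
      (\<Sum>i\<in>I - {k}. \<Sum>j\<in>I - {k}. of_nat (a i) * of_nat (a j) *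
        ct (I - {k}) (\<alpha> + unit_exp i + unit_exp j - unit_exp k - unit_exp k)) = 0"
    by (intro sum.neutral ballI, subst *)
      (simp_all only: lookup2, simp_all)
  show "Poly_Mapping.lookup \<alpha> k \<noteq> 2 \<Longrightarrow>
      (\<Sum>i\<in>I - {k}. of_nat (a i) *
        ct (I - {k}) (\<alpha> + unit_exp i + unit_exp i - unit_exp k - unit_exp k)) = 0"
    by (intro sum.neutral ballI, subst *)
      (simp_all only: lookup2, simp_all)
qed

lemma dyson_ct_zero_exponent_deg_neg:
  assumes "finite I" "k \<in> I" "a k = 0" "Poly_Mapping.lookup \<alpha> k < 0"
  shows "(dyson_ct I \<alpha> a :: rat) = 0"
proof -
  have deg: "Poly_Mapping.lookup \<alpha> k \<le> 2" "Poly_Mapping.lookup \<alpha> k \<noteq> 0"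
    "Poly_Mapping.lookup \<alpha> k \<noteq> 1" "Poly_Mapping.lookup \<alpha> k \<noteq> 2"
    using assms(4) by auto
  have "dyson_ct (I - {k}) \<alpha> a = (0 :: rat)"
    by (rule dyson_ct_eq_0[OF _ deg(2)]) simp
  then show ?thesis
    using dyson_ct_zero_exponent[where a = a and 'a = rat, OF assms(1-3) deg(1)]
    unfolding dyson_ct_shifted_sums_eq_0(1)[OF deg(3)] dyson_ct_shifted_sums_eq_0(2,3)[OF deg(4)]
    by simp
qed

lemma dyson_ct_zero_exponent_deg_0:
  assumes "finite I" "k \<in> I" "a k = 0" "Poly_Mapping.lookup \<alpha> k = 0"
  shows "(dyson_ct I \<alpha> a :: rat) = dyson_ct (I - {k}) \<alpha> a"
proof -
  have deg: "Poly_Mapping.lookup \<alpha> k \<le> 2"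
    "Poly_Mapping.lookup \<alpha> k \<noteq> 1" "Poly_Mapping.lookup \<alpha> k \<noteq> 2"
    using assms(4) by auto
  show ?thesis
    using dyson_ct_zero_exponent[where a = a and 'a = rat, OF assms(1-3) deg(1)]
    unfolding dyson_ct_shifted_sums_eq_0(1)[OF deg(2)] dyson_ct_shifted_sums_eq_0(2,3)[OF deg(3)]
    by simp
qed

lemma dyson_ct_zero_exponent_deg_1:
  assumes "finite I" "k \<in> I" "a k = 0" "Poly_Mapping.lookup \<alpha> k = 1"
  shows "(dyson_ct I \<alpha> a :: rat)
    = - (\<Sum>i\<in>I - {k}. of_nat (a i) * dyson_ct (I - {k}) (\<alpha> + unit_exp i - unit_exp k) a)"
proof -
  have deg: "Poly_Mapping.lookup \<alpha> k \<le> 2"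
    "Poly_Mapping.lookup \<alpha> k \<noteq> 0" "Poly_Mapping.lookup \<alpha> k \<noteq> 2"
    using assms(4) by auto
  have "dyson_ct (I - {k}) \<alpha> a = (0 :: rat)"
    by (rule dyson_ct_eq_0[OF _ deg(2)]) simp
  then show ?thesis
    using dyson_ct_zero_exponent[where a = a and 'a = rat, OF assms(1-3) deg(1)]
    unfolding dyson_ct_shifted_sums_eq_0(2,3)[OF deg(3)]
    by simp
qed

lemma dyson_ct_zero_exponent_deg_2:
  assumes "finite I" "k \<in> I" "a k = 0" "Poly_Mapping.lookup \<alpha> k = 2"
  defines "J \<equiv> I - {k}"
  shows "2 * (dyson_ct I \<alpha> a :: rat)
    = (\<Sum>i\<in>J. \<Sum>j\<in>J. of_nat (a i) * of_nat (a j) *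
         dyson_ct J (\<alpha> + unit_exp i + unit_exp j - unit_exp k - unit_exp k) a)
    - (\<Sum>i\<in>J. of_nat (a i) *
         dyson_ct J (\<alpha> + unit_exp i + unit_exp i - unit_exp k - unit_exp k) a)"
proof -
  have deg: "Poly_Mapping.lookup \<alpha> k \<le> 2"
    "Poly_Mapping.lookup \<alpha> k \<noteq> 0" "Poly_Mapping.lookup \<alpha> k \<noteq> 1"
    using assms(4) by auto
  have "dyson_ct J \<alpha> a = (0 :: rat)"
    unfolding J_def by (rule dyson_ct_eq_0[OF _ deg(2)]) simp
  then show ?thesis
    using dyson_ct_zero_exponent[where a = a and 'a = rat, OF assms(1-3) deg(1)]
    unfolding dyson_ct_shifted_sums_eq_0(1)[OF deg(3)] J_def
    by (simp only:)
qed

section \<open>Good's induction and multinomial coefficients\<close>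

text \<open>
  Either some exponent vanishes and its index can be dropped, or all are positive and the
  recurrence applies; the sum of the exponents plus the number of indices decreases both times.
\<close>

lemma good_induct [consumes 1, case_names empty zero pos]:
  fixes I :: "nat set" and a :: "nat \<Rightarrow> nat"
  assumes "finite I"
    and empty: "\<And>a. P {} a"
    and zero: "\<And>I a k. finite I \<Longrightarrow> k \<in> I \<Longrightarrow> a k = 0 \<Longrightarrow> P (I - {k}) a \<Longrightarrow> P I a"
    and pos: "\<And>I a. finite I \<Longrightarrow> I \<noteq> {} \<Longrightarrow> (\<And>k. k \<in> I \<Longrightarrow> a k > 0) \<Longrightarrow>
      (\<And>k. k \<in> I \<Longrightarrow> P I (a(k := a k - 1))) \<Longrightarrow> P I a"
  shows "P I a"
  using assms(1)
proof (induction "card I + sum a I" arbitrary: I a rule: less_induct)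
  case less
  consider "I = {}" | k where "k \<in> I" "a k = 0" | "I \<noteq> {}" "\<And>k. k \<in> I \<Longrightarrow> a k > 0"
    by auto
  then show ?case
  proof cases
    case 1
    then show ?thesis by (simp add: empty)
  next
    case 2
    have "card (I - {k}) + sum a (I - {k}) < card I + sum a I"
      using 2 less.prems card_Diff1_less[OF less.prems 2(1)] by (simp add: sum.remove)
    then show ?thesis
      using 2 less by (intro zero[of I k a]) auto
  next
    case 3
    have dec: "P I (a(k := a k - 1))" if "k \<in> I" for k
    proof -
      have "sum (a(k := a k - 1)) I < sum a I"
        using 3(2)[OF that] that less.prems by (simp add: sum.remove)
      then show ?thesis using less by simp
    qed
    show ?thesis by (rule pos[OF less.prems 3(1)]) (erule 3(2), erule dec)
  qed
qed

definition exponent_sum :: "nat set \<Rightarrow> (nat \<Rightarrow> nat) \<Rightarrow> rat" where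
  "exponent_sum I a = (\<Sum>i\<in>I. of_nat (a i))"

lemma exponent_sum_remove: "finite I \<Longrightarrow> k \<in> I \<Longrightarrow> exponent_sum I a = of_nat (a k) + exponent_sum (I - {k}) a"
  by (simp add: exponent_sum_def sum.remove)

lemma exponent_sum_remove_zero_exponent:
  "finite I \<Longrightarrow> a k = 0 \<Longrightarrow> exponent_sum (I - {k} - {r}) a = exponent_sum (I - {r}) a"
  unfolding exponent_sum_def by (intro sum.mono_neutral_left) auto

lemma exponent_sum_nonneg: "exponent_sum I a \<ge> 0"
  by (simp add: exponent_sum_def sum_nonneg)

lemma exponent_sum_ge: "finite I \<Longrightarrow> k \<in> I \<Longrightarrow> of_nat (a k) \<le> exponent_sum I a"
  using exponent_sum_nonneg[of "I - {k}" a] by (simp add: exponent_sum_remove)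

lemma exponent_sum_decrement:
  assumes "finite I" "a k > 0"
  shows "exponent_sum I (a(k := a k - 1)) = exponent_sum I a - (if k \<in> I then 1 else 0)"
proof (cases "k \<in> I")
  case True
  then show ?thesis
    using assms by (simp add: exponent_sum_remove[of I k]) (simp add: exponent_sum_def of_nat_diff)
next
  case False
  then show ?thesis by (auto simp: exponent_sum_def intro!: sum.cong)
qed

definition multinom :: "nat set \<Rightarrow> (nat \<Rightarrow> nat) \<Rightarrow> rat" where
  "multinom I a = fact (\<Sum>i\<in>I. a i) / (\<Prod>i\<in>I. fact (a i))"

lemma multinom_zero_exponent:
  "finite I \<Longrightarrow> k \<in> I \<Longrightarrow> a k = 0 \<Longrightarrow> multinom I a = multinom (I - {k}) a"
  by (simp add: multinom_def sum.remove prod.remove)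

lemma multinom_decrement:
  assumes "finite I" "k \<in> I" "a k > 0"
  shows "exponent_sum I a * multinom I (a(k := a k - 1)) = of_nat (a k) * multinom I a"
proof -
  obtain m where m: "a k = Suc m" using assms(3) by (cases "a k") auto
  let ?s = "\<Sum>i\<in>I - {k}. a i" and ?q = "\<Prod>i\<in>I - {k}. fact (a i) :: rat"
  have dec: "multinom I (a(k := m)) = fact (m + ?s) / (fact m * ?q)"
    using assms(1,2) by (simp add: multinom_def sum.remove prod.remove)
  have orig: "multinom I a = of_nat (Suc (m + ?s)) * fact (m + ?s) / (of_nat (Suc m) * fact m * ?q)"
    using assms(1,2) m by (simp add: multinom_def sum.remove prod.remove)
  have tot: "exponent_sum I a = of_nat (Suc (m + ?s))"
    using assms(1,2) m by (simp add: exponent_sum_def sum.remove)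
  have "of_nat (Suc m) \<noteq> (0 :: rat)"
    by (simp del: of_nat_Suc)
  then show ?thesis
    unfolding orig tot m using dec by (simp del: of_nat_Suc of_nat_add)
qed

text \<open>
  Since \<open>(\<Sum>i. a\<^sub>i) C(a - e\<^sub>k) = a\<^sub>k C(a)\<close>, Good's recurrence for \<open>R(a) C(a)\<close> is an identity between
  values of the factor \<open>R\<close> alone, in which the multinomial coefficients no longer occur.
\<close>

lemma dyson_ct_recurrence_step:
  assumes "finite I" "I \<noteq> {}" "\<And>k. k \<in> I \<Longrightarrow> a k > 0"
    and IH: "\<And>k. k \<in> I \<Longrightarrow> dyson_ct I \<alpha> (a(k := a k - 1))
      = R (a(k := a k - 1)) * multinom I (a(k := a k - 1))"
    and R: "(\<Sum>k\<in>I. of_nat (a k) * R (a(k := a k - 1))) = exponent_sum I a * R a"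
  shows "dyson_ct I \<alpha> a = R a * multinom I a"
proof -
  obtain k where "k \<in> I" using assms(2) by blast
  then have nz: "exponent_sum I a \<noteq> 0"
    using exponent_sum_ge[OF assms(1) \<open>k \<in> I\<close>, of a] assms(3)[of k] by auto
  have "exponent_sum I a * dyson_ct I \<alpha> a
      = exponent_sum I a * (\<Sum>k\<in>I. R (a(k := a k - 1)) * multinom I (a(k := a k - 1)))"
    by (simp only: dyson_ct_good_recurrence[OF assms(1-3)] IH cong: sum.cong)
  also have "\<dots> = (\<Sum>k\<in>I. R (a(k := a k - 1)) * (exponent_sum I a * multinom I (a(k := a k - 1))))"
    by (simp add: sum_distrib_left mult_ac)
  also have "\<dots> = (\<Sum>k\<in>I. of_nat (a k) * R (a(k := a k - 1))) * multinom I a"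
    unfolding sum_distrib_right
    by (intro sum.cong refl) (simp add: multinom_decrement[unfolded One_nat_def] assms(1,3))
  also have "\<dots> = exponent_sum I a * (R a * multinom I a)"
    by (simp only: R mult.assoc)
  finally show ?thesis using nz by simp
qed

text \<open>
  Dyson's conjecture: both the recurrence and the boundary condition are those of the multinomial
  coefficient itself.
\<close>

theorem dyson_constant_term:
  assumes "finite I"
  shows "dyson_ct I 0 a = multinom I a"
  using assms
proof (induction I a rule: good_induct)
  case (empty a)
  then show ?case by (simp add: dyson_ct_def dyson_def multinom_def constant_term_def lookup_one when_def)
next
  case (zero I a k)
  then show ?case
    by (simp add: dyson_ct_zero_exponent_deg_0[of I k] multinom_zero_exponent[of I k])
next
  case (pos I a)
  have "dyson_ct I 0 a = (\<lambda>_. 1) a * multinom I a"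
    by (rule dyson_ct_recurrence_step[OF pos.hyps]) (simp_all only: pos.IH mult_1, simp add: exponent_sum_def)
  then show ?case by simp
qed

section \<open>The constant term with \<open>x\<^sub>s / x\<^sub>r\<close> in front\<close>

definition first_order_factor :: "nat set \<Rightarrow> nat \<Rightarrow> (nat \<Rightarrow> nat) \<Rightarrow> rat" where
  "first_order_factor I r a = - of_nat (a r) / (1 + exponent_sum (I - {r}) a)"

text \<open>
  At \<open>a s = 0\<close> the elimination of \<open>x\<^sub>s\<close> produces the monomials \<open>x\<^sub>i / x\<^sub>r\<close> with weights \<open>- a\<^sub>i\<close>; for \<open>i = r\<close>
  this is the constant term itself, which is where the value \<open>- a\<^sub>r / (1 + A)\<close> originates.
\<close>

theorem dyson_ct_first_order:
  assumes "finite I" "r \<in> I" "s \<in> I" "r \<noteq> s"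
  shows "dyson_ct I (unit_exp s - unit_exp r) a = first_order_factor I r a * multinom I a"
  using assms
proof (induction I a arbitrary: s rule: good_induct)
  case (empty a)
  then show ?case by simp
next
  case (zero I a k)
  let ?\<alpha> = "unit_exp s - unit_exp r"
  have lookup: "Poly_Mapping.lookup ?\<alpha> k = (if k = s then 1 else 0) - (if k = r then 1 else 0)"
    by (simp add: lookup_minus lookup_single when_def)
  consider "k = r" | "k = s" | "k \<noteq> r" "k \<noteq> s" by blast
  then show ?case
  proof cases
    case 1
    then have "dyson_ct I ?\<alpha> a = (0 :: rat)"
      using zero lookup by (intro dyson_ct_zero_exponent_deg_neg[of I k]) auto
    then show ?thesis using 1 zero by (simp add: first_order_factor_def)
  next
    case 2
    let ?J = "I - {k}" and ?K = "I - {k} - {r}"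
    let ?A = "exponent_sum ?K a"
    have r: "r \<in> ?J" using 2 zero by auto
    have K: "dyson_ct ?J (unit_exp i - unit_exp r) a = first_order_factor ?J r a * multinom ?J a"
      if "i \<in> ?K" for i
      using that r zero.IH zero.prems by auto
    have shift: "?\<alpha> + unit_exp i - unit_exp k = unit_exp i - unit_exp r" for i
      using 2 by simp
    have "dyson_ct I ?\<alpha> a
        = - (\<Sum>i\<in>?J. of_nat (a i) * dyson_ct ?J (unit_exp i - unit_exp r) a :: rat)"
      using dyson_ct_zero_exponent_deg_1[where a = a, OF zero.hyps, of ?\<alpha>] lookup 2 zero.prems
      unfolding shift by simp
    also have "\<dots> = - (of_nat (a r) * multinom ?J a
           + (\<Sum>i\<in>?K. of_nat (a i) * (first_order_factor ?J r a * multinom ?J a)))"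
    proof -
      have "(\<Sum>i\<in>?K. of_nat (a i) * dyson_ct ?J (unit_exp i - unit_exp r) a)
          = (\<Sum>i\<in>?K. of_nat (a i) * (first_order_factor ?J r a * multinom ?J a))"
        by (intro sum.cong refl) (simp only: K)
      then show ?thesis
        using zero.hyps(1) by (simp add: sum.remove[OF _ r] dyson_constant_term)
    qed
    also have "\<dots> = - (of_nat (a r) + ?A * first_order_factor ?J r a) * multinom ?J a"
      by (simp only: exponent_sum_def sum_distrib_right[symmetric]) (simp add: algebra_simps)
    also have "of_nat (a r) + ?A * first_order_factor ?J r a = - first_order_factor ?J r a"
      using exponent_sum_nonneg[of ?K a] by (simp add: first_order_factor_def field_simps)
    also have "first_order_factor ?J r a = first_order_factor I r a"
      using zero.hyps by (simp add: first_order_factor_def exponent_sum_remove_zero_exponent)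
    finally show ?thesis using zero.hyps by (simp add: multinom_zero_exponent[of I k])
  next
    case 3
    then show ?thesis
      using zero lookup
      by (simp add: dyson_ct_zero_exponent_deg_0[of I k] multinom_zero_exponent[of I k]
          first_order_factor_def exponent_sum_remove_zero_exponent)
  qed
next
  case (pos I a)
  let ?p = "of_nat (a r) :: rat" and ?A = "exponent_sum (I - {r}) a"
  have "?A > 0"
    using exponent_sum_ge[of "I - {r}" s a] pos.hyps(1) pos.hyps(3)[of s] pos.prems by (auto intro: less_le_trans[rotated])
  have "of_nat (a r - 1) = ?p - 1"
    using pos.hyps(3)[OF pos.prems(1)] by (simp add: of_nat_diff)
  then have r: "first_order_factor I r (a(r := a r - 1)) = - (?p - 1) / (1 + ?A)"
    using pos.hyps(1,3) pos.prems
    by (simp add: first_order_factor_def exponent_sum_decrement[unfolded One_nat_def])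
  have other: "first_order_factor I r (a(k := a k - 1)) = - ?p / ?A" if "k \<in> I - {r}" for k
    using that pos.hyps(1) pos.hyps(3)[of k]
    by (simp add: first_order_factor_def exponent_sum_decrement[unfolded One_nat_def])
  have "(\<Sum>k\<in>I. of_nat (a k) * first_order_factor I r (a(k := a k - 1)))
      = ?p * (- (?p - 1) / (1 + ?A)) + (\<Sum>k\<in>I - {r}. of_nat (a k) * (- ?p / ?A))"
    using pos.hyps(1) pos.prems r other by (simp add: sum.remove)
  also have "\<dots> = ?p * (- (?p - 1) / (1 + ?A)) + ?A * (- ?p / ?A)"
    by (simp add: exponent_sum_def sum_distrib_right sum_negf sum_divide_distrib)
  also have "\<dots> = exponent_sum I a * first_order_factor I r a"
    using \<open>?A > 0\<close> pos.hyps(1) pos.prems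
    by (simp add: first_order_factor_def exponent_sum_remove[of I r] field_simps)
  finally show ?case
    by (intro dyson_ct_recurrence_step[OF pos.hyps] pos.IH[OF _ pos.prems])
qed

section \<open>The constant term with \<open>x\<^sub>s x\<^sub>t / x\<^sub>r\<^sup>2\<close> in front\<close>

text \<open>
  Here \<open>A\<close> will be the sum of all exponents other than \<open>a\<^sub>r\<close>, and \<open>q\<close> one of these exponents.
\<close>

definition ratio :: "rat \<Rightarrow> nat \<Rightarrow> rat" where
  "ratio A q = of_nat q / (1 + A - of_nat q)"

lemma ratio_0 [simp]: "ratio A 0 = 0"
  by (simp add: ratio_def)

text \<open>
  Summation of \<open>q * ratio A q = (1 + A) * ratio A q - q\<close>.
\<close>

lemma sum_mult_ratio:
  assumes "finite M" "\<And>i. i \<in> M \<Longrightarrow> of_nat (a i) \<le> A"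
  shows "(\<Sum>i\<in>M. of_nat (a i) * ratio A (a i)) = (1 + A) * (\<Sum>i\<in>M. ratio A (a i)) - exponent_sum M a"
proof -
  have "of_nat (a i) * ratio A (a i) = (1 + A) * ratio A (a i) - of_nat (a i)" if "i \<in> M" for i
    using assms(2)[OF that] by (simp add: ratio_def field_simps)
  then show ?thesis
    by (simp add: exponent_sum_def sum_subtractf sum_distrib_left)
qed

text \<open>
  The part of the second-order formula that depends on \<open>s\<close> and \<open>t\<close>; \<open>K\<close> is the index set without \<open>r\<close>.
\<close>

definition correction :: "nat set \<Rightarrow> nat \<Rightarrow> nat \<Rightarrow> (nat \<Rightarrow> nat) \<Rightarrow> rat" where
  "correction K s t a = (if s = t then 1 else 0) + (\<Sum>j\<in>K - {s, t}. ratio (exponent_sum K a) (a j))"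

text \<open>
  With \<open>\<Psi>\<close> the sum of the ratios over \<open>K - {t}\<close>, the correction is \<open>1 + \<Psi>\<close> for \<open>i = t\<close> and
  \<open>\<Psi>\<close> minus the ratio of \<open>i\<close> otherwise; the weighted sum of the latter ratios is
  evaluated by \<open>sum_mult_ratio\<close>.
\<close>

lemma weighted_correction_left:
  assumes "finite K" "t \<in> K"
  shows "(\<Sum>i\<in>K. of_nat (a i) * correction K i t a)
    = exponent_sum K a - (\<Sum>j\<in>K - {t}. ratio (exponent_sum K a) (a j))"
proof -
  let ?A = "exponent_sum K a" and ?\<phi> = "\<lambda>j. ratio (exponent_sum K a) (a j)" and ?L = "K - {t}"
  let ?\<Psi> = "\<Sum>j\<in>?L. ?\<phi> j"
  have "correction K t t a = 1 + ?\<Psi>"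
    by (simp add: correction_def)
  have other: "correction K i t a = ?\<Psi> - ?\<phi> i" if "i \<in> ?L" for i
  proof -
    have "K - {i, t} = ?L - {i}" by auto
    then show ?thesis using that assms(1) by (simp add: correction_def sum_diff1)
  qed
  have "(\<Sum>i\<in>K. of_nat (a i) * correction K i t a)
      = of_nat (a t) * (1 + ?\<Psi>) + (\<Sum>i\<in>?L. of_nat (a i) * (?\<Psi> - ?\<phi> i))"
  proof -
    have "(\<Sum>i\<in>?L. of_nat (a i) * correction K i t a) = (\<Sum>i\<in>?L. of_nat (a i) * (?\<Psi> - ?\<phi> i))"
      by (intro sum.cong refl) (simp only: other)
    then show ?thesis
      using assms \<open>correction K t t a = 1 + ?\<Psi>\<close> by (simp add: sum.remove)
  qed
  also have "(\<Sum>i\<in>?L. of_nat (a i) * (?\<Psi> - ?\<phi> i)) = exponent_sum ?L a * ?\<Psi> - (\<Sum>i\<in>?L. of_nat (a i) * ?\<phi> i)"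
    by (simp add: exponent_sum_def right_diff_distrib sum_subtractf sum_distrib_right)
  also have "(\<Sum>i\<in>?L. of_nat (a i) * ?\<phi> i) = (1 + ?A) * ?\<Psi> - exponent_sum ?L a"
    using assms(1) by (intro sum_mult_ratio) (auto intro: exponent_sum_ge)
  also have "of_nat (a t) = ?A - exponent_sum ?L a"
    using exponent_sum_remove[OF assms, of a] by simp
  finally show ?thesis by (simp add: algebra_simps)
qed

lemma weighted_correction_both:
  assumes "finite K"
  shows "(\<Sum>i\<in>K. \<Sum>j\<in>K. of_nat (a i) * of_nat (a j) * correction K i j a)
    = exponent_sum K a * exponent_sum K a - exponent_sum K a + (\<Sum>j\<in>K. ratio (exponent_sum K a) (a j))"
proof -
  let ?A = "exponent_sum K a" and ?\<phi> = "\<lambda>j. ratio (exponent_sum K a) (a j)"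
  let ?\<Phi> = "\<Sum>j\<in>K. ?\<phi> j"
  have "(\<Sum>i\<in>K. \<Sum>j\<in>K. of_nat (a i) * of_nat (a j) * correction K i j a)
      = (\<Sum>j\<in>K. of_nat (a j) * (\<Sum>i\<in>K. of_nat (a i) * correction K i j a))"
    by (subst sum.swap) (simp add: sum_distrib_left mult_ac)
  also have "\<dots> = (\<Sum>j\<in>K. of_nat (a j) * (?A - ?\<Phi> + ?\<phi> j))"
    using assms by (intro sum.cong) (simp_all add: weighted_correction_left sum_diff1)
  also have "\<dots> = ?A * (?A - ?\<Phi>) + (\<Sum>j\<in>K. of_nat (a j) * ?\<phi> j)"
    by (simp add: exponent_sum_def distrib_left sum.distrib sum_distrib_right)
  also have "(\<Sum>j\<in>K. of_nat (a j) * ?\<phi> j) = (1 + ?A) * ?\<Phi> - ?A"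
    using assms by (intro sum_mult_ratio) (auto intro: exponent_sum_ge)
  finally show ?thesis by (simp add: algebra_simps)
qed

lemma weighted_correction_diag:
  assumes "finite K"
  shows "(\<Sum>i\<in>K. of_nat (a i) * correction K i i a)
    = 2 * exponent_sum K a - (\<Sum>j\<in>K. ratio (exponent_sum K a) (a j))"
proof -
  let ?A = "exponent_sum K a" and ?\<phi> = "\<lambda>j. ratio (exponent_sum K a) (a j)"
  let ?\<Phi> = "\<Sum>j\<in>K. ?\<phi> j"
  have "(\<Sum>i\<in>K. of_nat (a i) * correction K i i a) = (\<Sum>i\<in>K. of_nat (a i) * (1 + ?\<Phi> - ?\<phi> i))"
    using assms by (intro sum.cong) (simp_all add: correction_def sum_diff1)
  also have "\<dots> = ?A * (1 + ?\<Phi>) - (\<Sum>i\<in>K. of_nat (a i) * ?\<phi> i)"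
    by (simp add: exponent_sum_def right_diff_distrib sum_subtractf sum_distrib_right)
  also have "(\<Sum>i\<in>K. of_nat (a i) * ?\<phi> i) = (1 + ?A) * ?\<Phi> - ?A"
    using assms by (intro sum_mult_ratio) (auto intro: exponent_sum_ge)
  finally show ?thesis by (simp add: algebra_simps)
qed

definition second_order_factor :: "nat set \<Rightarrow> nat \<Rightarrow> nat \<Rightarrow> nat \<Rightarrow> (nat \<Rightarrow> nat) \<Rightarrow> rat" where
  "second_order_factor I r s t a = (let p = of_nat (a r); A = exponent_sum (I - {r}) a in
     p / ((1 + A) * (2 + A)) * (2 * p + A - (1 + p + A) * correction (I - {r}) s t a))"

lemma second_order_factor_commute: "second_order_factor I r s t a = second_order_factor I r t s a"
  by (simp add: second_order_factor_def correction_def insert_commute eq_commute)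

lemma second_order_factor_zero_exponent:
  assumes "finite I" "a k = 0" "k \<noteq> s" "k \<noteq> t"
  shows "second_order_factor (I - {k}) r s t a = second_order_factor I r s t a"
proof -
  have "(\<Sum>j\<in>I - {k} - {r} - {s, t}. ratio A (a j)) = (\<Sum>j\<in>I - {r} - {s, t}. ratio A (a j))" for A
    using assms by (intro sum.mono_neutral_left) auto
  then show ?thesis
    using assms by (simp add: second_order_factor_def correction_def Let_def exponent_sum_remove_zero_exponent)
qed

text \<open>
  The boundary condition at \<open>a s = 0\<close> for \<open>s \<noteq> t\<close>: the left-hand side arises from the elimination of \<open>x\<^sub>s\<close>
  in \<open>x\<^sub>s x\<^sub>t / x\<^sub>r\<^sup>2\<close>, its first summand from the replacement of \<open>x\<^sub>s\<close> by \<open>x\<^sub>r\<close>.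
\<close>

lemma second_order_factor_zero_s:
  assumes "finite I" "r \<in> I" "t \<in> I" "s \<in> I" "r \<noteq> t" "r \<noteq> s" "s \<noteq> t" "a s = 0"
  defines "J \<equiv> I - {s}"
  shows "- (of_nat (a r) * first_order_factor J r a
      + (\<Sum>i\<in>J - {r}. of_nat (a i) * second_order_factor J r i t a))
    = second_order_factor I r s t a"
proof -
  let ?K = "J - {r}" and ?p = "of_nat (a r) :: rat"
  let ?A = "exponent_sum ?K a" let ?\<Psi> = "\<Sum>j\<in>?K - {t}. ratio ?A (a j)"
  define c where "c = ?p / ((1 + ?A) * (2 + ?A))"
  have fac: "second_order_factor J r i t a = c * (2 * ?p + ?A - (1 + ?p + ?A) * correction ?K i t a)" for i
    by (simp add: second_order_factor_def Let_def c_def)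
  have "(\<Sum>i\<in>?K. of_nat (a i) * second_order_factor J r i t a)
      = (\<Sum>i\<in>?K. c * (of_nat (a i) * (2 * ?p + ?A)
          - (1 + ?p + ?A) * (of_nat (a i) * correction ?K i t a)))"
    by (intro sum.cong) (simp_all add: fac algebra_simps)
  also have "\<dots> = c * (?A * (2 * ?p + ?A) - (1 + ?p + ?A) * (\<Sum>i\<in>?K. of_nat (a i) * correction ?K i t a))"
    by (simp only: sum_distrib_left[symmetric] sum_distrib_right[symmetric] sum_subtractf exponent_sum_def)
  also have "(\<Sum>i\<in>?K. of_nat (a i) * correction ?K i t a) = ?A - ?\<Psi>"
    using assms by (intro weighted_correction_left) auto
  finally have sum: "(\<Sum>i\<in>?K. of_nat (a i) * second_order_factor J r i t a)
      = c * (?A * (2 * ?p + ?A) - (1 + ?p + ?A) * (?A - ?\<Psi>))" .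
  have tot: "exponent_sum (I - {r}) a = ?A"
    using assms by (simp add: J_def exponent_sum_remove_zero_exponent)
  have "I - {r} - {s, t} = ?K - {t}" by (auto simp: J_def)
  then have "second_order_factor I r s t a = c * (2 * ?p + ?A - (1 + ?p + ?A) * ?\<Psi>)"
    using assms(7) by (simp add: second_order_factor_def correction_def Let_def tot c_def)
  moreover have "1 + ?A \<noteq> 0" "2 + ?A \<noteq> 0"
    using exponent_sum_nonneg[of ?K a] by auto
  ultimately show ?thesis
    unfolding sum first_order_factor_def c_def by (simp add: divide_simps) (simp add: algebra_simps)
qed

text \<open>
  The boundary condition at \<open>a s = 0\<close> for \<open>s = t\<close>.  The left-hand side is what the quadratic form
  from the elimination of \<open>x\<^sub>s\<close> in \<open>x\<^sub>s\<^sup>2 / x\<^sub>r\<^sup>2\<close> yields, with the terms in which \<open>x\<^sub>r\<close> occurs twice, once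
  and not at all listed separately.
\<close>

lemma second_order_factor_zero_st:
  assumes "finite I" "r \<in> I" "s \<in> I" "r \<noteq> s" "a s = 0"
  defines "J \<equiv> I - {s}" and "K \<equiv> I - {s} - {r}"
  defines "p \<equiv> of_nat (a r)"
  shows "p * p + 2 * p * (exponent_sum K a * first_order_factor J r a)
      + (\<Sum>i\<in>K. \<Sum>j\<in>K. of_nat (a i) * of_nat (a j) * second_order_factor J r i j a)
      - p - (\<Sum>i\<in>K. of_nat (a i) * second_order_factor J r i i a)
    = 2 * second_order_factor I r s s a"
proof -
  let ?A = "exponent_sum K a" let ?\<Phi> = "\<Sum>j\<in>K. ratio ?A (a j)"
  define c where "c = p / ((1 + ?A) * (2 + ?A))"
  have K: "K = J - {r}" "finite K" using assms(1) by (auto simp: J_def K_def)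
  have fac: "second_order_factor J r i j a = c * (2 * p + ?A - (1 + p + ?A) * correction K i j a)" for i j
    by (simp add: second_order_factor_def Let_def c_def p_def K(1))
  have "(\<Sum>i\<in>K. \<Sum>j\<in>K. of_nat (a i) * of_nat (a j) * second_order_factor J r i j a)
      = (\<Sum>i\<in>K. \<Sum>j\<in>K. c * (of_nat (a i) * (of_nat (a j) * (2 * p + ?A))
          - (1 + p + ?A) * (of_nat (a i) * of_nat (a j) * correction K i j a)))"
    by (intro sum.cong refl) (simp add: fac algebra_simps)
  also have "\<dots> = c * (?A * (?A * (2 * p + ?A)) - (1 + p + ?A) *
      (\<Sum>i\<in>K. \<Sum>j\<in>K. of_nat (a i) * of_nat (a j) * correction K i j a))"
    by (simp only: sum_distrib_left[symmetric] sum_distrib_right[symmetric] sum_subtractf exponent_sum_def)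
  finally have both: "(\<Sum>i\<in>K. \<Sum>j\<in>K. of_nat (a i) * of_nat (a j) * second_order_factor J r i j a)
      = c * (?A * (?A * (2 * p + ?A)) - (1 + p + ?A) * (?A * ?A - ?A + ?\<Phi>))"
    by (simp only: weighted_correction_both[OF K(2)])
  have "(\<Sum>i\<in>K. of_nat (a i) * second_order_factor J r i i a)
      = (\<Sum>i\<in>K. c * (of_nat (a i) * (2 * p + ?A)
          - (1 + p + ?A) * (of_nat (a i) * correction K i i a)))"
    by (intro sum.cong refl) (simp add: fac algebra_simps)
  also have "\<dots> = c * (?A * (2 * p + ?A) - (1 + p + ?A) * (\<Sum>i\<in>K. of_nat (a i) * correction K i i a))"
    by (simp only: sum_distrib_left[symmetric] sum_distrib_right[symmetric] sum_subtractf exponent_sum_def)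
  finally have diag: "(\<Sum>i\<in>K. of_nat (a i) * second_order_factor J r i i a)
      = c * (?A * (2 * p + ?A) - (1 + p + ?A) * (2 * ?A - ?\<Phi>))"
    by (simp only: weighted_correction_diag[OF K(2)])
  have tot: "exponent_sum (I - {r}) a = ?A"
    using assms by (simp add: K_def exponent_sum_remove_zero_exponent)
  have "I - {r} - {s, s} = K" by (auto simp: K_def)
  then have "second_order_factor I r s s a = c * (2 * p + ?A - (1 + p + ?A) * (1 + ?\<Phi>))"
    by (simp add: second_order_factor_def correction_def Let_def tot c_def p_def)
  moreover have "first_order_factor J r a = - p / (1 + ?A)"
    by (simp add: first_order_factor_def K(1) p_def)
  moreover have "1 + ?A \<noteq> 0" "2 + ?A \<noteq> 0"
    using exponent_sum_nonneg[of K a] by auto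
  ultimately show ?thesis
    unfolding both diag c_def by (simp add: divide_simps) algebra
qed

text \<open>
  Each summand involves only \<open>a r\<close>, the sum \<open>A\<close> and, for the terms indexed by \<open>j\<close>, \<open>a j\<close>.  So the
  decrements of all other exponents have the same effect on it, with total weight \<open>A\<close> or
  \<open>A - a j\<close>, and what remains is an identity of rational functions in two or three unknowns.  It
  makes no division by zero after the decrement: \<open>A - a j > 0\<close> because \<open>s\<close> is another index in \<open>K\<close>.
\<close>

lemma second_order_factor_recurrence:
  assumes "finite I" "r \<in> I" "s \<in> I" "t \<in> I" "r \<noteq> s" "r \<noteq> t"
    and pos: "\<And>k. k \<in> I \<Longrightarrow> a k > 0"
  shows "(\<Sum>k\<in>I. of_nat (a k) * second_order_factor I r s t (a(k := a k - 1)))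
    = exponent_sum I a * second_order_factor I r s t a"
proof -
  define K where "K = I - {r}"
  define L where "L = K - {s, t}"
  define A where "A = exponent_sum K a"
  define p where "p = (of_nat (a r) :: rat)"
  define q where "q j = (of_nat (a j) :: rat)" for j
  define \<delta> :: rat where "\<delta> = (if s = t then 1 else 0)"
  \<comment> \<open>The part of the factor without ratios, and the summand of one index \<open>j\<close>, as functions of
    \<open>p = a r\<close>, \<open>q = a j\<close> and \<open>A\<close>.\<close>
  define f0 :: "rat \<Rightarrow> rat \<Rightarrow> rat" where
    "f0 p A = p * (2 * p + A - (1 + p + A) * \<delta>) / ((1 + A) * (2 + A))" for p A
  define f1 :: "rat \<Rightarrow> rat \<Rightarrow> rat \<Rightarrow> rat" where
    "f1 p q A = p * (1 + p + A) * q / ((1 + A) * (2 + A) * (1 + A - q))" for p q A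
  have fin: "finite K" "finite L" "L \<subseteq> K" and s: "s \<in> K"
    using assms by (auto simp: K_def L_def)
  have factor: "second_order_factor I r s t b
      = f0 (of_nat (b r)) (exponent_sum K b) - (\<Sum>j\<in>L. f1 (of_nat (b r)) (of_nat (b j)) (exponent_sum K b))" for b
  proof -
    let ?p = "of_nat (b r) :: rat" and ?A = "exponent_sum K b"
    let ?c = "?p * (1 + ?p + ?A) / ((1 + ?A) * (2 + ?A))"
    have "f1 ?p (of_nat (b j)) ?A = ?c * ratio ?A (b j)" for j
      by (simp add: f1_def ratio_def)
    then have "(\<Sum>j\<in>L. f1 ?p (of_nat (b j)) ?A) = ?c * (\<Sum>j\<in>L. ratio ?A (b j))"
      by (simp only: sum_distrib_left)
    moreover have "x / d * (u - w * (\<delta> + X)) = x * (u - w * \<delta>) / d - x * w / d * X"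
      for x d u w X :: rat
      by (simp add: algebra_simps diff_divide_distrib add_divide_distrib)
    ultimately show ?thesis
      by (simp only: second_order_factor_def correction_def Let_def f0_def \<delta>_def[symmetric]
          K_def[symmetric] L_def[symmetric])
  qed
  \<comment> \<open>The denominators \<open>1 + A - q j\<close> must stay nonzero when \<open>A\<close> is lowered by one.\<close>
  have A_ge: "A - q j > 0" if "j \<in> L" for j
  proof -
    have "A = q j + exponent_sum (K - {j}) a"
      using that fin by (simp add: A_def q_def exponent_sum_remove[of K j] subset_iff)
    moreover have "q s \<le> exponent_sum (K - {j}) a"
      unfolding q_def using that s fin by (intro exponent_sum_ge) (auto simp: L_def)
    moreover have "q s > 0" using pos assms(3) by (simp add: q_def)
    ultimately show ?thesis by linarith
  qed
  have A_pos: "A > 0"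
    using exponent_sum_ge[OF fin(1) s, of a] pos[OF assms(3)] unfolding A_def
    by (auto intro: less_le_trans[rotated])
  have dec: "(of_nat (a k - 1) :: rat) = of_nat (a k) - 1" if "k \<in> I" for k
    using pos[OF that] by (simp add: of_nat_diff)
  have r: "second_order_factor I r s t (a(r := a r - 1)) = f0 (p - 1) A - (\<Sum>j\<in>L. f1 (p - 1) (q j) A)"
  proof -
    have "exponent_sum K (a(r := a r - 1)) = A"
      unfolding A_def using fin pos assms(2) by (subst exponent_sum_decrement) (simp_all add: K_def)
    moreover have "(\<Sum>j\<in>L. f1 (p - 1) (of_nat ((a(r := a r - 1)) j)) A) = (\<Sum>j\<in>L. f1 (p - 1) (q j) A)"
      by (intro sum.cong) (auto simp: q_def L_def K_def)
    ultimately show ?thesis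
      unfolding factor by (simp only: fun_upd_same dec[OF assms(2)] p_def)
  qed
  have other: "second_order_factor I r s t (a(k := a k - 1))
      = f0 p (A - 1) - (\<Sum>j\<in>L. f1 p (q j - (if j = k then 1 else 0)) (A - 1))" if k: "k \<in> K" for k
  proof -
    have kI: "k \<in> I" and kr: "r \<noteq> k" using k by (auto simp: K_def)
    have "exponent_sum K (a(k := a k - 1)) = A - 1"
      unfolding A_def using fin pos[OF kI] k by (subst exponent_sum_decrement) simp_all
    moreover have "(\<Sum>j\<in>L. f1 p (of_nat ((a(k := a k - 1)) j)) (A - 1))
        = (\<Sum>j\<in>L. f1 p (q j - (if j = k then 1 else 0)) (A - 1))"
      using dec[OF kI] by (intro sum.cong) (auto simp: q_def)
    ultimately show ?thesis
      unfolding factor using kr by (simp only: fun_upd_other p_def not_False_eq_True)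
  qed
  have inner: "(\<Sum>k\<in>K. q k * f1 p (q j - (if j = k then 1 else 0)) (A - 1))
      = q j * f1 p (q j - 1) (A - 1) + (A - q j) * f1 p (q j) (A - 1)" if "j \<in> L" for j
  proof -
    have j: "j \<in> K" using that fin by auto
    have "(\<Sum>k\<in>K. q k * f1 p (q j - (if j = k then 1 else 0)) (A - 1))
        = q j * f1 p (q j - 1) (A - 1) + (\<Sum>k\<in>K - {j}. q k * f1 p (q j) (A - 1))"
      using fin j by (subst sum.remove[of K j]) (auto intro!: sum.cong)
    also have "(\<Sum>k\<in>K - {j}. q k * f1 p (q j) (A - 1)) = (A - q j) * f1 p (q j) (A - 1)"
      using exponent_sum_remove[OF fin(1) j, of a]
      by (simp add: sum_distrib_right[symmetric] A_def q_def exponent_sum_def)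
    finally show ?thesis .
  qed
  have f0_rec: "p * f0 (p - 1) A + A * f0 p (A - 1) = (p + A) * f0 p A"
  proof -
    have "A \<noteq> 0" "1 + A \<noteq> 0" "2 + A \<noteq> 0" using A_pos by auto
    then show ?thesis
      unfolding f0_def by (simp add: divide_simps) (simp add: algebra_simps)
  qed
  have f1_rec: "p * f1 (p - 1) (q j) A + (q j * f1 p (q j - 1) (A - 1) + (A - q j) * f1 p (q j) (A - 1))
      = (p + A) * f1 p (q j) A" if "j \<in> L" for j
  proof -
    have "A \<noteq> 0" "1 + A \<noteq> 0" "2 + A \<noteq> 0" "A - q j \<noteq> 0" "1 + A - q j \<noteq> 0"
      using A_pos A_ge[OF that] by auto
    then show ?thesis
      unfolding f1_def by (simp add: divide_simps) algebra
  qed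
  have "(\<Sum>k\<in>I. of_nat (a k) * second_order_factor I r s t (a(k := a k - 1)))
      = p * second_order_factor I r s t (a(r := a r - 1))
        + (\<Sum>k\<in>K. q k * second_order_factor I r s t (a(k := a k - 1)))"
    unfolding p_def q_def K_def by (rule sum.remove[OF assms(1,2)])
  also have "(\<Sum>k\<in>K. q k * second_order_factor I r s t (a(k := a k - 1)))
      = (\<Sum>k\<in>K. q k * (f0 p (A - 1) - (\<Sum>j\<in>L. f1 p (q j - (if j = k then 1 else 0)) (A - 1))))"
    by (intro sum.cong refl) (simp only: other)
  also have "\<dots> = A * f0 p (A - 1)
      - (\<Sum>k\<in>K. \<Sum>j\<in>L. q k * f1 p (q j - (if j = k then 1 else 0)) (A - 1))"
    by (simp add: right_diff_distrib sum_subtractf sum_distrib_left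
        sum_distrib_right[symmetric] A_def q_def exponent_sum_def)
  also have "(\<Sum>k\<in>K. \<Sum>j\<in>L. q k * f1 p (q j - (if j = k then 1 else 0)) (A - 1))
      = (\<Sum>j\<in>L. q j * f1 p (q j - 1) (A - 1) + (A - q j) * f1 p (q j) (A - 1))"
    by (subst sum.swap) (intro sum.cong refl inner)
  also have "p * second_order_factor I r s t (a(r := a r - 1)) + (A * f0 p (A - 1)
      - (\<Sum>j\<in>L. q j * f1 p (q j - 1) (A - 1) + (A - q j) * f1 p (q j) (A - 1)))
    = (p * f0 (p - 1) A + A * f0 p (A - 1)) - (\<Sum>j\<in>L. p * f1 (p - 1) (q j) A +
        (q j * f1 p (q j - 1) (A - 1) + (A - q j) * f1 p (q j) (A - 1)))"
    unfolding r by (simp add: right_diff_distrib sum_distrib_left sum.distrib)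
  also have "\<dots> = (p + A) * f0 p A - (\<Sum>j\<in>L. (p + A) * f1 p (q j) A)"
    by (simp only: f0_rec f1_rec cong: sum.cong)
  also have "\<dots> = (p + A) * second_order_factor I r s t a"
    by (simp add: factor p_def q_def A_def sum_distrib_left right_diff_distrib)
  also have "p + A = exponent_sum I a"
    using exponent_sum_remove[OF assms(1,2), of a] by (simp add: p_def A_def K_def)
  finally show ?thesis .
qed

text \<open>
  The induction has to treat all \<open>s\<close> and \<open>t\<close> simultaneously, since the elimination of \<open>x\<^sub>s\<close> replaces it by
  each of the other variables.
\<close>

theorem dyson_ct_second_order:
  assumes "finite I" "r \<in> I" "s \<in> I" "t \<in> I" "r \<noteq> s" "r \<noteq> t"
  shows "dyson_ct I (unit_exp s + unit_exp t - unit_exp r - unit_exp r) a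
    = second_order_factor I r s t a * multinom I a"
  using assms
proof (induction I a arbitrary: s t rule: good_induct)
  case (empty a)
  then show ?case by simp
next
  case (zero I a k)
  let ?\<alpha> = "\<lambda>s t. unit_exp s + unit_exp t - unit_exp r - unit_exp r"
  let ?J = "I - {k}" and ?K = "I - {k} - {r}"
  let ?M = "multinom ?J a"
  have lookup: "Poly_Mapping.lookup (?\<alpha> s t) k = (if k = s then 1 else 0) + (if k = t then 1 else 0)
      - (if k = r then 1 else 0) - (if k = r then 1 else 0)" for s t
    by (simp only: lookup_add lookup_minus lookup_single when_def) auto
  have M: "multinom I a = ?M"
    using zero.hyps by (simp add: multinom_zero_exponent)
  have IH: "dyson_ct ?J (?\<alpha> i j) a = second_order_factor ?J r i j a * ?M"
    if "i \<in> ?K" "j \<in> ?K" "k \<noteq> r" for i j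
    using that zero.prems by (intro zero.IH) auto
  have first: "dyson_ct ?J (unit_exp j - unit_exp r) a = first_order_factor ?J r a * ?M"
    if "j \<in> ?K" "k \<noteq> r" for j
    using that zero.hyps zero.prems by (intro dyson_ct_first_order) auto
  \<comment> \<open>The case \<open>k = s\<close>, for every \<open>t\<close>, so that it also yields the case \<open>k = t\<close> by symmetry.\<close>
  have key: "dyson_ct I (?\<alpha> k t) a = second_order_factor I r k t a * ?M"
    if "k \<noteq> t" "t \<in> I" "r \<noteq> t" "k \<noteq> r" for t
  proof -
    have r: "r \<in> ?J" and t: "t \<in> ?K" using that zero.prems by auto
    have shift: "?\<alpha> k t + unit_exp i - unit_exp k = ?\<alpha> i t" for i
      by (simp add: algebra_simps)
    have "dyson_ct I (?\<alpha> k t) a = - (\<Sum>i\<in>?J. of_nat (a i) * dyson_ct ?J (?\<alpha> i t) a :: rat)"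
      using dyson_ct_zero_exponent_deg_1[where a = a, OF zero.hyps(1-3), of "?\<alpha> k t"] lookup[of k t] that
      unfolding shift by simp
    also have "(\<Sum>i\<in>?J. of_nat (a i) * dyson_ct ?J (?\<alpha> i t) a :: rat)
        = of_nat (a r) * dyson_ct ?J (?\<alpha> r t) a + (\<Sum>i\<in>?K. of_nat (a i) * dyson_ct ?J (?\<alpha> i t) a)"
      using zero.hyps(1) r by (intro sum.remove) auto
    also have "?\<alpha> r t = unit_exp t - unit_exp r"
      by simp
    also have "(\<Sum>i\<in>?K. of_nat (a i) * dyson_ct ?J (?\<alpha> i t) a)
        = (\<Sum>i\<in>?K. of_nat (a i) * second_order_factor ?J r i t a) * ?M"
      unfolding sum_distrib_right
      by (intro sum.cong refl) (simp only: IH[OF _ t that(4)] mult.assoc)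
    also have "dyson_ct ?J (unit_exp t - unit_exp r) a = first_order_factor ?J r a * ?M"
      by (rule first[OF t that(4)])
    also have "- (of_nat (a r) * (first_order_factor ?J r a * ?M)
        + (\<Sum>i\<in>?K. of_nat (a i) * second_order_factor ?J r i t a) * ?M)
      = - (of_nat (a r) * first_order_factor ?J r a
        + (\<Sum>i\<in>?K. of_nat (a i) * second_order_factor ?J r i t a)) * ?M"
      by (simp add: algebra_simps)
    also have "- (of_nat (a r) * first_order_factor ?J r a
        + (\<Sum>i\<in>?K. of_nat (a i) * second_order_factor ?J r i t a)) = second_order_factor I r k t a"
      using that zero.hyps zero.prems by (intro second_order_factor_zero_s) auto
    finally show ?thesis .
  qed
  consider "k = r" | "k \<notin> {r, s, t}" | "k = s" "s \<noteq> t" "k \<noteq> r" | "k = t" "s \<noteq> t" "k \<noteq> r"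
    | "k = s" "s = t" "k \<noteq> r"
    by auto
  then show ?case
  proof cases
    case 1
    then have "dyson_ct I (?\<alpha> s t) a = (0 :: rat)"
      using zero.hyps zero.prems lookup[of s t]
      by (intro dyson_ct_zero_exponent_deg_neg[of I k]) simp_all
    moreover have "second_order_factor I r s t a = 0"
      using 1 zero.hyps by (simp add: second_order_factor_def)
    ultimately show ?thesis by simp
  next
    case 2
    then have "dyson_ct I (?\<alpha> s t) a = (dyson_ct ?J (?\<alpha> s t) a :: rat)"
      using zero.hyps lookup[of s t]
      by (intro dyson_ct_zero_exponent_deg_0) auto
    also have "\<dots> = second_order_factor ?J r s t a * ?M"
      using 2 zero.prems by (intro IH) auto
    finally show ?thesis
      using 2 zero.hyps by (simp add: M second_order_factor_zero_exponent)
  next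
    case 3
    then show ?thesis using key[of t] zero.prems M by simp
  next
    case 4
    then show ?thesis
      using key[of s] zero.prems M second_order_factor_commute[of I r s t a] by (simp add: add.commute)
  next
    case 5
    let ?p = "of_nat (a r) :: rat"
    have r: "r \<in> ?J" using 5 zero.prems by auto
    have fin: "finite ?J" using zero.hyps by simp
    have shift: "?\<alpha> k k + unit_exp i + unit_exp j - unit_exp k - unit_exp k = ?\<alpha> i j" for i j
      by (simp add: algebra_simps)
    have rr: "dyson_ct ?J (?\<alpha> r r) a = ?M"
      using dyson_constant_term[OF fin] by simp
    have rj: "dyson_ct ?J (?\<alpha> r j) a = first_order_factor ?J r a * ?M"
      and jr: "dyson_ct ?J (?\<alpha> j r) a = first_order_factor ?J r a * ?M" if "j \<in> ?K" for j
      using first[OF that 5(3)] by (simp_all add: algebra_simps)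
    have "2 * dyson_ct I (?\<alpha> k k) a
        = (\<Sum>i\<in>?J. \<Sum>j\<in>?J. of_nat (a i) * of_nat (a j) * dyson_ct ?J (?\<alpha> i j) a)
          - (\<Sum>i\<in>?J. of_nat (a i) * dyson_ct ?J (?\<alpha> i i) a :: rat)"
      using dyson_ct_zero_exponent_deg_2[where a = a, OF zero.hyps(1-3), of "?\<alpha> k k"] lookup[of k k] 5(3)
      unfolding shift by simp
    also have "(\<Sum>i\<in>?J. of_nat (a i) * dyson_ct ?J (?\<alpha> i i) a :: rat)
        = ?p * ?M + (\<Sum>i\<in>?K. of_nat (a i) * second_order_factor ?J r i i a) * ?M"
      unfolding sum.remove[OF fin r] rr sum_distrib_right
      by (intro arg_cong2[where f = "(+)"] refl sum.cong) (simp only: IH 5(3) mult.assoc not_False_eq_True)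
    also have "(\<Sum>i\<in>?J. \<Sum>j\<in>?J. of_nat (a i) * of_nat (a j) * dyson_ct ?J (?\<alpha> i j) a)
        = (?p * ?p * ?M + (\<Sum>j\<in>?K. ?p * of_nat (a j) * (first_order_factor ?J r a * ?M)))
          + (\<Sum>i\<in>?K. of_nat (a i) * ?p * (first_order_factor ?J r a * ?M)
             + (\<Sum>j\<in>?K. of_nat (a i) * of_nat (a j) * (second_order_factor ?J r i j a * ?M)))"
      unfolding sum.remove[OF fin r] rr
      by (intro arg_cong2[where f = "(+)"] refl sum.cong)
        (simp_all only: IH rj jr 5(3) not_False_eq_True)
    also have "\<dots> - (?p * ?M + (\<Sum>i\<in>?K. of_nat (a i) * second_order_factor ?J r i i a) * ?M)
      = (?p * ?p + 2 * ?p * (exponent_sum ?K a * first_order_factor ?J r a)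
         + (\<Sum>i\<in>?K. \<Sum>j\<in>?K. of_nat (a i) * of_nat (a j) * second_order_factor ?J r i j a)
         - ?p - (\<Sum>i\<in>?K. of_nat (a i) * second_order_factor ?J r i i a)) * ?M"
      by (simp add: exponent_sum_def sum.distrib sum_distrib_left sum_distrib_right algebra_simps)
    also have "\<dots> = 2 * second_order_factor I r k k a * ?M"
      using second_order_factor_zero_st[of I r k a] zero.hyps zero.prems 5 by simp
    finally show ?thesis using 5 M by simp
  qed
next
  case (pos I a)
  show ?case
    using pos.hyps pos.prems
    by (intro dyson_ct_recurrence_step[OF pos.hyps] pos.IH[OF _ pos.prems]
        second_order_factor_recurrence)
qed

theorem theorem1p2:
  fixes n :: nat and a :: "nat \<Rightarrow> nat" and r s :: nat
  assumes "r \<in> {1..n}" and "s \<in> {1..n}" and "r \<noteq> s"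
  shows "constant_term (xpow s 2 * xpow r (- 2) * dyson_product n a :: rat laurent) =
    of_nat (a r) /
      ((1 + of_nat (dyson_sum_except n a r)) * (2 + of_nat (dyson_sum_except n a r))) *
    ((of_nat (a r) - 1) -
      (\<Sum>i \<in> {1..n} - {r, s}. of_nat (a i) * (1 + of_nat (dyson_sum n a)) /
         (1 + of_nat (dyson_sum_except n a r) - of_nat (a i)))) *
    dyson_coeff n a"
proof -
  let ?I = "{1..n}" let ?p = "of_nat (a r) :: rat" and ?A = "exponent_sum ({1..n} - {r}) a"
  let ?\<Phi> = "\<Sum>i\<in>?I - {r, s}. ratio ?A (a i)"
  have total: "of_nat (dyson_sum n a) = ?p + ?A"
    using assms(1) exponent_sum_remove[of ?I r a] by (simp add: dyson_sum_def exponent_sum_def)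
  have "a r \<le> dyson_sum n a"
    unfolding dyson_sum_def using assms(1) by (intro member_le_sum) auto
  then have except: "of_nat (dyson_sum_except n a r) = ?A"
    using total by (simp add: dyson_sum_except_def of_nat_diff)
  have split: "?I - {r} - {s, s} = ?I - {r, s}" by auto
  have "xpow s 2 * xpow r (- 2)
      = (monomial (unit_exp s + unit_exp s - unit_exp r - unit_exp r) :: rat laurent)"
    by (simp add: xpow_def mult_single algebra_simps single_uminus flip: single_add)
  then have "constant_term (xpow s 2 * xpow r (- 2) * dyson_product n a :: rat laurent)
      = dyson_ct ?I (unit_exp s + unit_exp s - unit_exp r - unit_exp r) a"
    by (simp only: dyson_ct_def dyson_product_eq)
  also have "\<dots> = second_order_factor ?I r s s a * multinom ?I a"
    using assms by (intro dyson_ct_second_order) auto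
  also have "multinom ?I a = dyson_coeff n a"
    by (simp add: multinom_def dyson_coeff_def dyson_sum_def)
  also have "second_order_factor ?I r s s a
      = ?p / ((1 + ?A) * (2 + ?A)) * ((?p - 1) - (1 + (?p + ?A)) * ?\<Phi>)"
    unfolding second_order_factor_def correction_def Let_def split by (simp add: algebra_simps)
  also have "(1 + (?p + ?A)) * ?\<Phi> = (\<Sum>i\<in>?I - {r, s}. of_nat (a i) * (1 + (?p + ?A)) / (1 + ?A - of_nat (a i)))"
    by (simp add: ratio_def sum_distrib_left mult.commute)
  finally show ?thesis
    by (simp only: total except)
qed

end
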